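(* Let $w_{1},w_{2},w_{3}$ be any odd positive integers and $n\ge0$ an integer. Then for all $y_1$: \begin{align*} &\sum_{k+l+m=n}\binom{n}{k,l,m}E_{k}(w_{1}y_{1})T_{l}(w_{2}-1)T_{m}(w_{3}-1)w_{1}^{l+m}w_{2}^{k+m}w_{3}^{k+l}\\ =&\sum_{k+l+m=n}\binom{n}{k,l,m}E_{k}(w_2y_{1})T_{l}(w_{3}-1)T_{m}(w_{1}-1)w_{2}^{l+m}w_{3}^{k+m}w_{1}^{k+l}\\ =&\sum_{k+l+m=n}\binom{n}{k,l,m}E_{k}(w_{3}y_{1})T_{l}(w_{1}-1)T_{m}(w_{2}-1)w_{3}^{l+m}w_{1}^{k+m}w_{2}^{k+l}. \end{align*}
   Context: The Euler polynomials $E_n(x)$ are defined by $\frac{2}{e^{t}+1}e^{xt}=\sum_{n=0}^{\infty}E_{n}(x)\frac{t^{n}}{n!}$. For integers $k,N\ge0$, $T_{k}(N)=\sum_{i=0}^{N}(-1)^{i}i^{k}$, with the convention $0^0=1$. Sums $\sum_{k+l+m=n}$ run over all nonnegative integers $k,l,m$ with $k+l+m=n$, and $\binom{n}{k,l,m}=\frac{n!}{k!\,l!\,m!}$. *)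

theory Defs
  imports "HOL-Computational_Algebra.Formal_Power_Series"
begin

text \<open>
  The value at \<open>x\<close> of the \<open>n\<close>-th Euler polynomial, read off from the exponential generating
  function \<open>2 / (e^t + 1) * e^(x t)\<close>, a formal power series in \<open>t\<close>.  The denominator has constant
  coefficient 2, hence is a unit.
\<close>

definition euler_poly :: "nat \<Rightarrow> 'a \<Rightarrow> 'a :: field_char_0" where
  "euler_poly n x = fact n * fps_nth (2 / (fps_exp 1 + 1) * fps_exp x) n"

lemma euler_poly_gen_fun:
  "Abs_fps (\<lambda>n. euler_poly n x / fact n) = 2 / (fps_exp 1 + 1) * fps_exp (x :: 'a :: field_char_0)"
  by (simp add: fps_eq_iff euler_poly_def)

definition alt_power_sum :: "nat \<Rightarrow> nat \<Rightarrow> 'a :: comm_ring_1" where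
  "alt_power_sum k N = (\<Sum>i=0..N. (-1) ^ i * of_nat i ^ k)"

definition trinomial :: "nat \<Rightarrow> nat \<Rightarrow> nat \<Rightarrow> nat \<Rightarrow> 'a :: field_char_0" where
  "trinomial n k l m = fact n / (fact k * fact l * fact m)"

end

theory Submission
  imports Defs
begin

text \<open>
  Put \<open>W = w\<^sub>1 w\<^sub>2 w\<^sub>3\<close>.  The first sum is \<open>n!\<close> times the coefficient of \<open>t^n\<close> in a product of three
  exponential generating functions, one for the Euler polynomials and two for the alternating power
  sums.  Since the \<open>w\<^sub>i\<close> are odd, the latter are quotients \<open>(e^(W t) + 1) / (e^(w\<^sub>1 w\<^sub>3 t) + 1)\<close> and
  \<open>(e^(W t) + 1) / (e^(w\<^sub>1 w\<^sub>2 t) + 1)\<close> of finite geometric series, so that the product is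
  \<open>2 e^(W y\<^sub>1 t) (e^(W t) + 1)^2 / ((e^(w\<^sub>2 w\<^sub>3 t) + 1) (e^(w\<^sub>1 w\<^sub>3 t) + 1) (e^(w\<^sub>1 w\<^sub>2 t) + 1))\<close>,
  which is symmetric in \<open>w\<^sub>1, w\<^sub>2, w\<^sub>3\<close>.
\<close>

definition euler_egf :: "'a \<Rightarrow> 'a \<Rightarrow> 'a :: field_char_0 fps" where
  "euler_egf c x = Abs_fps (\<lambda>k. euler_poly k x * c ^ k / fact k)"

definition alt_power_sum_egf :: "'a \<Rightarrow> nat \<Rightarrow> 'a :: field_char_0 fps" where
  "alt_power_sum_egf c N = Abs_fps (\<lambda>k. alt_power_sum k N * c ^ k / fact k)"

text \<open>The constant coefficient is 2, nonzero in characteristic 0. This permits cancelling the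
  denominators at the end.\<close>

lemma fps_exp_plus_one_nonzero: "fps_exp c + 1 \<noteq> (0 :: 'a :: field_char_0 fps)"
proof
  assume "fps_exp c + 1 = (0 :: 'a fps)"
  then have "fps_nth (fps_exp c + 1) 0 = (0 :: 'a)" by simp
  then show False by simp
qed

lemma euler_egf_times:
  fixes c x :: "'a :: field_char_0"
  shows "euler_egf c x * (fps_exp c + 1) = 2 * fps_exp (c * x)"
proof -
  let ?g = "2 / (fps_exp 1 + 1) * fps_exp x :: 'a fps"
  let ?cX = "fps_const c * fps_X :: 'a fps"
  have unit: "fps_nth (fps_exp 1 + 1 :: 'a fps) 0 \<noteq> 0" by simp
  have "?g * (fps_exp 1 + 1) = 2 * fps_exp x"
    using unit by (simp add: fps_divide_unit mult_ac inverse_mult_eq_1')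
  \<comment> \<open>Composing with \<open>?cX\<close> replaces t by c t; it respects products
    because \<open>?cX\<close> has zero constant term.\<close>
  then have "(?g * (fps_exp 1 + 1)) oo ?cX = (2 * fps_exp x) oo ?cX"
    by (rule arg_cong)
  then have "(?g oo ?cX) * ((fps_exp 1 + 1) oo ?cX) = (2 oo ?cX) * (fps_exp x oo ?cX)"
    using fps_compose_mult_distrib[of ?cX ?g "fps_exp 1 + 1"]
      fps_compose_mult_distrib[of ?cX 2 "fps_exp x"] by simp
  moreover have "?g oo ?cX = euler_egf c x"
    by (simp add: fps_eq_iff fps_compose_linear euler_egf_def euler_poly_def)
  moreover have "(fps_exp 1 + 1) oo ?cX = fps_exp c + 1"
    by (simp add: fps_compose_add_distrib)
  moreover have "2 oo ?cX = 2"
    by (simp add: numeral_fps_const)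
  moreover have "fps_exp x oo ?cX = fps_exp (c * x)"
    by simp
  ultimately show ?thesis by simp
qed

lemma alternating_geometric_sum:
  fixes q :: "'a :: comm_ring_1"
  shows "(\<Sum>i=0..N. (-1) ^ i * q ^ i) * (q + 1) = 1 + (-1) ^ N * q ^ Suc N"
  by (induction N) (simp_all add: algebra_simps)

text \<open>For fixed i, the terms (i c)^k / k! are the coefficients of e^(i c t); the convention
  0^0 = 1 makes this hold at i = 0 too.\<close>

lemma alt_power_sum_egf_eq_sum:
  "alt_power_sum_egf c N = (\<Sum>i=0..N. (-1) ^ i * fps_exp c ^ i)"
proof (rule fps_ext)
  fix k
  have "fps_nth ((-1) ^ i * fps_exp c ^ i) k = (-1) ^ i * of_nat i ^ k * c ^ k / fact k" for i
    \<comment> \<open>Fixing the parity turns the power of -1 into a plain sign.\<close>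
    by (cases "even i") (simp_all add: fps_exp_power_mult power_mult_distrib)
  then show "fps_nth (alt_power_sum_egf c N) k = fps_nth (\<Sum>i=0..N. (-1) ^ i * fps_exp c ^ i) k"
    by (simp add: alt_power_sum_egf_def alt_power_sum_def fps_sum_nth sum_distrib_right
        sum_divide_distrib)
qed

text \<open>Oddness makes the last index w - 1 even, so the boundary term of the geometric sum has
  sign +.\<close>

lemma alt_power_sum_egf_times:
  assumes "odd w"
  shows "alt_power_sum_egf c (w - 1) * (fps_exp c + 1) = fps_exp (of_nat w * c) + 1"
proof -
  from assms have "even (w - 1)" "Suc (w - 1) = w" by (auto elim: oddE)
  then show ?thesis
    using alternating_geometric_sum[where q = "fps_exp c" and N = "w - 1"]
    by (simp add: alt_power_sum_egf_eq_sum fps_exp_power_mult)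
qed

lemma fps_mult3_nth:
  fixes f g h :: "'a :: comm_semiring_0 fps"
  shows "fps_nth (f * g * h) n
    = (\<Sum>(k, l, m) \<in> {(k, l, m). k + l + m = n}. fps_nth f k * fps_nth g l * fps_nth h m)"
proof -
  have "fps_nth (f * (g * h)) n
    = (\<Sum>(k, l) \<in> (SIGMA k:{0..n}. {0..n-k}). fps_nth f k * (fps_nth g l * fps_nth h (n - k - l)))"
    by (simp add: fps_mult_nth sum_distrib_left sum.Sigma)
  also have "\<dots> = (\<Sum>(k, l, m) \<in> {(k, l, m). k + l + m = n}.
      fps_nth f k * fps_nth g l * fps_nth h m)"
    \<comment> \<open>The third index is recovered as n - k - l; no truncation occurs, since l
      ranges only up to n - k.\<close>
    by (rule sum.reindex_bij_witness[where i = "\<lambda>(k, l, m). (k, l)" and j = "\<lambda>(k, l). (k, l, n - k - l)"])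
       (auto simp: mult.assoc)
  finally show ?thesis by (simp add: mult.assoc)
qed

definition euler_triple_egf :: "nat \<Rightarrow> nat \<Rightarrow> nat \<Rightarrow> 'a \<Rightarrow> 'a :: field_char_0 fps" where
  "euler_triple_egf u v w y = euler_egf (of_nat v * of_nat w) (of_nat u * y)
     * alt_power_sum_egf (of_nat u * of_nat w) (v - 1)
     * alt_power_sum_egf (of_nat u * of_nat v) (w - 1)"

text \<open>Regrouping u^(l+m) v^(k+m) w^(k+l) as (v w)^k (u w)^l (u v)^m gives each factor its own
  scaling of t.\<close>

lemma euler_triple_sum_eq_nth:
  "(\<Sum>(k, l, m) \<in> {(k, l, m). k + l + m = n}.
      trinomial n k l m * euler_poly k (of_nat u * y)
        * alt_power_sum l (v - 1) * alt_power_sum m (w - 1)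
        * of_nat u ^ (l + m) * of_nat v ^ (k + m) * of_nat w ^ (k + l))
   = fact n * fps_nth (euler_triple_egf u v w y) n"
  unfolding euler_triple_egf_def fps_mult3_nth sum_distrib_left
  by (rule sum.cong)
     (auto simp: euler_egf_def alt_power_sum_egf_def trinomial_def power_add power_mult_distrib
       mult_ac)

lemma euler_triple_egf_times:
  fixes y :: "'a :: field_char_0"
  assumes "odd v" and "odd w"
  shows "euler_triple_egf u v w y
      * ((fps_exp (of_nat v * of_nat w) + 1) * (fps_exp (of_nat u * of_nat w) + 1)
         * (fps_exp (of_nat u * of_nat v) + 1))
    = 2 * fps_exp (of_nat (u * v * w) * y) * (fps_exp (of_nat (u * v * w)) + 1)\<^sup>2"
proof -
  let ?A = "euler_egf (of_nat v * of_nat w) (of_nat u * y)"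
  let ?B = "alt_power_sum_egf (of_nat u * of_nat w) (v - 1) :: 'a fps"
  let ?C = "alt_power_sum_egf (of_nat u * of_nat v) (w - 1) :: 'a fps"
  let ?a = "fps_exp (of_nat v * of_nat w) + 1 :: 'a fps"
  let ?b = "fps_exp (of_nat u * of_nat w) + 1 :: 'a fps"
  let ?c = "fps_exp (of_nat u * of_nat v) + 1 :: 'a fps"
  have "?A * ?B * ?C * (?a * ?b * ?c) = (?A * ?a) * (?B * ?b) * (?C * ?c)"
    by (simp only: mult_ac)
  also have "\<dots> = 2 * fps_exp (of_nat (u * v * w) * y) * (fps_exp (of_nat (u * v * w)) + 1)\<^sup>2"
    unfolding euler_egf_times alt_power_sum_egf_times[OF assms(1)]
      alt_power_sum_egf_times[OF assms(2)]
    by (simp add: power2_eq_square mult_ac)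
  finally show ?thesis by (simp only: euler_triple_egf_def)
qed

text \<open>Multiplied by the symmetric product \<open>?D\<close>, both sides become the same
  symmetric series; \<open>?D\<close> cancels because power series over a field form an integral
  domain.\<close>

lemma euler_triple_egf_rotate:
  fixes y :: "'a :: field_char_0"
  assumes "odd u" and "odd v" and "odd w"
  shows "euler_triple_egf u v w y = euler_triple_egf v w u y"
proof -
  let ?D = "(fps_exp (of_nat v * of_nat w) + 1) * (fps_exp (of_nat u * of_nat w) + 1)
         * (fps_exp (of_nat u * of_nat v) + 1) :: 'a fps"
  have "euler_triple_egf u v w y * ?D = euler_triple_egf v w u y * ?D"
    using euler_triple_egf_times[OF assms(2,3), of u y] euler_triple_egf_times[OF assms(3,1), of v y]
    by (simp add: mult_ac)
  moreover have "?D \<noteq> 0"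
    by (simp add: fps_exp_plus_one_nonzero)
  ultimately show ?thesis by simp
qed

theorem theorem8:
  fixes w\<^sub>1 w\<^sub>2 w\<^sub>3 n :: nat and y\<^sub>1 :: "'a :: field_char_0"
  assumes "odd w\<^sub>1" and "odd w\<^sub>2" and "odd w\<^sub>3"
  shows "(\<Sum>(k, l, m) \<in> {(k, l, m). k + l + m = n}.
            trinomial n k l m * euler_poly k (of_nat w\<^sub>1 * y\<^sub>1)
              * alt_power_sum l (w\<^sub>2 - 1) * alt_power_sum m (w\<^sub>3 - 1)
              * of_nat w\<^sub>1 ^ (l + m) * of_nat w\<^sub>2 ^ (k + m) * of_nat w\<^sub>3 ^ (k + l))
         = (\<Sum>(k, l, m) \<in> {(k, l, m). k + l + m = n}.
            trinomial n k l m * euler_poly k (of_nat w\<^sub>2 * y\<^sub>1)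
              * alt_power_sum l (w\<^sub>3 - 1) * alt_power_sum m (w\<^sub>1 - 1)
              * of_nat w\<^sub>2 ^ (l + m) * of_nat w\<^sub>3 ^ (k + m) * of_nat w\<^sub>1 ^ (k + l))
         \<and> (\<Sum>(k, l, m) \<in> {(k, l, m). k + l + m = n}.
            trinomial n k l m * euler_poly k (of_nat w\<^sub>2 * y\<^sub>1)
              * alt_power_sum l (w\<^sub>3 - 1) * alt_power_sum m (w\<^sub>1 - 1)
              * of_nat w\<^sub>2 ^ (l + m) * of_nat w\<^sub>3 ^ (k + m) * of_nat w\<^sub>1 ^ (k + l))
         = (\<Sum>(k, l, m) \<in> {(k, l, m). k + l + m = n}.
            trinomial n k l m * euler_poly k (of_nat w\<^sub>3 * y\<^sub>1)
              * alt_power_sum l (w\<^sub>1 - 1) * alt_power_sum m (w\<^sub>2 - 1)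
              * of_nat w\<^sub>3 ^ (l + m) * of_nat w\<^sub>1 ^ (k + m) * of_nat w\<^sub>2 ^ (k + l))"
  unfolding euler_triple_sum_eq_nth
  using euler_triple_egf_rotate[OF assms, of y\<^sub>1] euler_triple_egf_rotate[OF assms(2,3,1), of y\<^sub>1]
  by simp

end
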